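(* If $A,B\in\mathbb{C}^{n\times n}$ are normal matrices, then $\operatorname{dc}(\operatorname{sp}(A),\operatorname{sp}(B))\le\operatorname{rank}(A-B)$.
   Context: $\operatorname{sp}(A)$ denotes the spectrum of $A$ as a multiset of complex numbers (eigenvalues counted with multiplicity). For a finite multiset $\mathcal{A}$ of complex numbers and a set $S\subseteq\mathbb{C}$, $\mathcal{A}\cap S$ is the multiset of those elements of $\mathcal{A}$ lying in $S$, with their multiplicities in $\mathcal{A}$, and $|\cdot|$ denotes cardinality counted with multiplicity. For finite multisets $\mathcal{A},\mathcal{B}$ of complex numbers, $\operatorname{dc}(\mathcal{A},\mathcal{B})=\max_{S}\bigl||\mathcal{A}\cap S|-|\mathcal{B}\cap S|\bigr|$, where $S$ ranges over all closed discs $\{x\in\mathbb{C}:|x-a|\le r\}$ with $a\in\mathbb{C}$, $r\in\mathbb{R}^+$. *)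

theory Defs
  imports
    "HOL-Computational_Algebra.Polynomial"
    "HOL-Analysis.Elementary_Metric_Spaces"
    "Jordan_Normal_Form.Char_Poly"
    "Jordan_Normal_Form.Schur_Decomposition"
    "Jordan_Normal_Form.DL_Rank"
begin

text \<open>Eigenvalues are counted with algebraic multiplicity.\<close>

definition spectrum_mset :: "complex mat \<Rightarrow> complex multiset" where
  "spectrum_mset A = proots (char_poly A)"

definition normal_mat :: "complex mat \<Rightarrow> bool" where
  "normal_mat A \<longleftrightarrow> square_mat A \<and> A * mat_adjoint A = mat_adjoint A * A"

definition disc_discrepancies :: "complex multiset \<Rightarrow> complex multiset \<Rightarrow> int set" where
  "disc_discrepancies M N =
     {\<bar>int (size {#x \<in># M. x \<in> cball a r#}) - int (size {#x \<in># N. x \<in> cball a r#})\<bar> |a r. r > 0}"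

definition disc_dist :: "complex multiset \<Rightarrow> complex multiset \<Rightarrow> int" where
  "disc_dist M N = Max (disc_discrepancies M N)"

text \<open>The set of discrepancies is finite and nonempty, so the maximum in
  \<^term>\<open>disc_dist M N\<close> is attained.\<close>

lemma finite_disc_discrepancies: "finite (disc_discrepancies M N)"
proof (rule finite_subset)
  show "disc_discrepancies M N \<subseteq> {0..int (size M + size N)}"
  proof
    fix d assume "d \<in> disc_discrepancies M N"
    then obtain a r where
      d: "d = \<bar>int (size {#x \<in># M. x \<in> cball a r#}) - int (size {#x \<in># N. x \<in> cball a r#})\<bar>"
      unfolding disc_discrepancies_def mem_Collect_eq by (elim exE conjE)
    have "size {#x \<in># M. x \<in> cball a r#} \<le> size M"
      and "size {#x \<in># N. x \<in> cball a r#} \<le> size N"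
      by (rule size_filter_mset_lesseq)+
    then show "d \<in> {0..int (size M + size N)}"
      unfolding d atLeastAtMost_iff by linarith
  qed
qed simp

lemma disc_discrepancies_nonempty: "disc_discrepancies M N \<noteq> {}"
  unfolding disc_discrepancies_def by (simp add: gt_ex)

end

theory Submission
  imports Defs
begin

text \<open>Suppose a closed disc of centre \<open>a\<close> and radius \<open>r\<close> contains \<open>p\<close> eigenvalues of \<open>A\<close> and \<open>q\<close>
  eigenvalues of \<open>B\<close>, and \<open>p > q + rank (A - B)\<close>. By a dimension count there is a nonzero vector
  \<open>x\<close> in the kernel of \<open>A - B\<close> that is orthogonal to the eigenvectors of \<open>A\<close> with eigenvalue outside
  the disc and to the eigenvectors of \<open>B\<close> with eigenvalue inside it. As \<open>A\<close> and \<open>B\<close> are normal, this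
  gives \<open>\<parallel>A x - a x\<parallel> \<le> r \<parallel>x\<parallel> < \<parallel>B x - a x\<parallel>\<close>, contradicting \<open>A x = B x\<close>.\<close>

section \<open>Counting homogeneous linear equations over a field\<close>

text \<open>Padding the list with zero vectors up to length \<open>n\<close> gives a square matrix
  with a zero row, hence a singular one. This is the form in which all dimension counts below are
  made. The product is bilinear, so callers concerned with Hermitian orthogonality must pass
  conjugated vectors.\<close>

lemma common_kernel_vector:
  fixes vs :: "'a :: field vec list"
  assumes vs: "set vs \<subseteq> carrier_vec n" and len: "length vs < n"
  obtains x where "x \<in> carrier_vec n" "x \<noteq> 0\<^sub>v n" "\<And>v. v \<in> set vs \<Longrightarrow> v \<bullet> x = 0"
proof -
  define ws where "ws = vs @ replicate (n - length vs) (0\<^sub>v n)"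
  define M where "M = mat_of_rows n ws"
  have lws: "length ws = n" using len by (simp add: ws_def)
  have ws: "set ws \<subseteq> carrier_vec n" using vs by (auto simp: ws_def)
  have M: "M \<in> carrier_mat n n" using lws by (simp add: M_def mat_of_rows_def)
  have row: "row M i = ws ! i" if "i < n" for i
    using that lws ws unfolding M_def by (simp add: subset_iff)
  \<comment> \<open>The last row of \<open>M\<close> is padding because
    \<open>length vs < n\<close>, so the last unit vector lies in the kernel of the
    transpose.\<close>
  have "transpose_mat M *\<^sub>v unit_vec n (n - 1) = 0\<^sub>v n"
  proof (rule eq_vecI)
    fix i assume i: "i < dim_vec (0\<^sub>v n :: 'a vec)"
    have "\<not> n - 1 < length vs" using len by linarith
    then have "ws ! (n - 1) = 0\<^sub>v n" using len by (simp add: ws_def nth_append)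
    moreover have "M $$ (n - 1, i) = row M (n - 1) $ i" using i M len by simp
    ultimately have "M $$ (n - 1, i) = 0" using i len row[of "n - 1"] by simp
    then show "(transpose_mat M *\<^sub>v unit_vec n (n - 1)) $ i = 0\<^sub>v n $ i"
      using i M len by (simp add: scalar_prod_right_unit)
  qed (use M in simp)
  moreover have "unit_vec n (n - 1) \<noteq> (0\<^sub>v n :: 'a vec)"
    using len by (intro unit_vec_nonzero) simp
  ultimately have "det (transpose_mat M) = 0"
    using M by (subst det_0_iff_vec_prod_zero_field[of _ n]) (auto intro!: exI[of _ "unit_vec n (n - 1)"])
  then have "det M = 0" using M by (simp add: det_transpose)
  then obtain x where x: "x \<in> carrier_vec n" "x \<noteq> 0\<^sub>v n" "M *\<^sub>v x = 0\<^sub>v n"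
    using det_0_iff_vec_prod_zero_field[OF M] by blast
  have "v \<bullet> x = 0" if "v \<in> set vs" for v
  proof -
    from that obtain i where i: "i < length vs" "v = vs ! i" by (auto simp: in_set_conv_nth)
    then have "v = row M i" using len row[of i] by (simp add: ws_def nth_append)
    moreover have "(M *\<^sub>v x) $ i = row M i \<bullet> x" using i len M by simp
    ultimately show ?thesis using x(3) i len by simp
  qed
  with x show thesis by (intro that)
qed

text \<open>Turns the rank into a number of equations that can be appended to other constraints.
  With a basis \<open>S\<close> of the column space chosen among the columns, \<open>M\<close> is
  the sum over \<open>s\<close> in \<open>S\<close> of the outer products of \<open>s\<close> with a
  coefficient vector \<open>f s\<close>; hence \<open>M *\<^sub>v x\<close> vanishes once every
  \<open>f s \<bullet> x\<close> does.\<close>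

lemma (in vec_space) rank_kernel_equations:
  assumes M: "M \<in> carrier_mat n nc"
  obtains vs where "set vs \<subseteq> carrier_vec nc" "length vs = rank M"
    "\<And>x. x \<in> carrier_vec nc \<Longrightarrow> (\<And>v. v \<in> set vs \<Longrightarrow> v \<bullet> x = 0) \<Longrightarrow> M *\<^sub>v x = 0\<^sub>v n"
proof -
  have C: "set (cols M) \<subseteq> carrier_vec n" using cols_dim[of M] M by auto
  obtain S where S: "maximal S (\<lambda>T. T \<subseteq> set (cols M) \<and> lin_indpt T)"
    using maximal_exists_superset[of "set (cols M)" "\<lambda>T. T \<subseteq> set (cols M) \<and> lin_indpt T" "{}"]
    by (auto simp: lin_dep_def)
  have rk: "rank M = card S" by (rule rank_card_indpt[OF M S])
  have SC: "S \<subseteq> set (cols M)" and Si: "lin_indpt S" using S by (auto simp: maximal_def)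
  have Sn: "S \<subseteq> carrier_vec n" and Sf: "finite S" using SC C by (auto intro: finite_subset)
  \<comment> \<open>Maximality of \<open>S\<close>: a column outside its span could be added without
    losing independence.\<close>
  have span: "c \<in> span S" if c: "c \<in> set (cols M)" for c
  proof (rule ccontr)
    assume ns: "c \<notin> span S"
    then have "c \<notin> S" using span_mem[of S c] Sn by auto
    moreover have "lin_indpt (S \<union> {c})"
      using lin_dep_iff_in_span[of S c] Sn Si C c ns \<open>c \<notin> S\<close> by auto
    ultimately show False using S c SC unfolding maximal_def by blast
  qed
  have "\<exists>a. c = lincomb a S" if "c \<in> set (cols M)" for c
    using span[OF that] finite_in_span[OF Sf, of c] Sn by auto
  then obtain a where a: "\<And>c. c \<in> set (cols M) \<Longrightarrow> c = lincomb (a c) S" by metis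
  \<comment> \<open>Entry \<open>j\<close> is the coefficient of \<open>s\<close> in the expansion
    of column \<open>j\<close> over \<open>S\<close>.\<close>
  define f where "f s = vec nc (\<lambda>j. a (col M j) s)" for s
  obtain ss where ss: "set ss = S" "distinct ss" using finite_distinct_list[OF Sf] by blast
  show thesis
  proof (rule that[of "map f ss"])
    show "set (map f ss) \<subseteq> carrier_vec nc" by (auto simp: f_def)
    show "length (map f ss) = rank M" using ss rk distinct_card by fastforce
    fix x assume x: "x \<in> carrier_vec nc" and ort: "\<And>v. v \<in> set (map f ss) \<Longrightarrow> v \<bullet> x = 0"
    show "M *\<^sub>v x = 0\<^sub>v n"
    proof (rule eq_vecI)
      fix i assume "i < dim_vec (0\<^sub>v n :: 'a vec)"
      then have i: "i < n" by simp
      have ent: "M $$ (i, j) = (\<Sum>s\<in>S. f s $ j * s $ i)" if j: "j < nc" for j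
      proof -
        have "col M j \<in> set (cols M)" using j M by (auto simp: cols_def)
        from a[OF this] have "col M j $ i = (\<Sum>s\<in>S. a (col M j) s * s $ i)"
          using lincomb_index[OF i Sn] by metis
        then show ?thesis using i j M by (simp add: f_def)
      qed
      have "(M *\<^sub>v x) $ i = (\<Sum>j<nc. (\<Sum>s\<in>S. f s $ j * s $ i) * x $ j)"
        using i M x ent by (auto simp: scalar_prod_def atLeast0LessThan intro!: sum.cong)
      also have "\<dots> = (\<Sum>s\<in>S. s $ i * (\<Sum>j<nc. f s $ j * x $ j))"
        unfolding sum_distrib_right sum_distrib_left
        by (subst sum.swap) (simp add: ac_simps)
      also have "\<dots> = (\<Sum>s\<in>S. s $ i * (f s \<bullet> x))"
        using x by (simp add: scalar_prod_def atLeast0LessThan)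
      also have "\<dots> = 0" using ort ss by (auto intro!: sum.neutral)
      finally show "(M *\<^sub>v x) $ i = 0\<^sub>v n $ i" using i by simp
    qed (use M in simp)
  qed
qed

section \<open>Eigenvectors inside an invariant set\<close>

text \<open>In coordinates in which \<open>A\<close> is upper triangular, subtracting the last relevant diagonal
  entry shortens the support of a vector, so a vector of minimal support is an eigenvector.\<close>

lemma invariant_set_eigenvector:
  fixes A :: "complex mat"
  assumes A: "A \<in> carrier_mat n n" and W: "W \<subseteq> carrier_vec n"
    and inv: "\<And>x c. x \<in> W \<Longrightarrow> A *\<^sub>v x - c \<cdot>\<^sub>v x \<in> W"
    and x0: "x0 \<in> W" "x0 \<noteq> 0\<^sub>v n"
  obtains x c where "x \<in> W" "x \<noteq> 0\<^sub>v n" "A *\<^sub>v x = c \<cdot>\<^sub>v x"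
proof -
  obtain es where "char_poly A = (\<Prod>e\<leftarrow>es. [:- e, 1:])" using char_poly_factorized[OF A] by blast
  from schur_decomposition_exists[OF A this] obtain T
    where T: "T \<in> carrier_mat n n" and ut: "upper_triangular T" and sim: "similar_mat A T" by blast
  from sim obtain P Q where "similar_mat_wit A T P Q" by (auto simp: similar_mat_def)
  from similar_mat_witD2[OF A this] have PQ: "P * Q = 1\<^sub>m n" "Q * P = 1\<^sub>m n" and AT: "A = P * T * Q"
    and P: "P \<in> carrier_mat n n" and Q: "Q \<in> carrier_mat n n" by auto
  have "Q * A = (Q * P) * (T * Q)" using P Q T by (simp add: AT assoc_mult_mat[of _ n n _ n _ n])
  then have QA: "Q * A = T * Q" using PQ T Q by simp
  define R where "R m x \<longleftrightarrow> x \<in> W \<and> x \<noteq> 0\<^sub>v n \<and> (\<forall>i<n. m \<le> i \<longrightarrow> (Q *\<^sub>v x) $ i = 0)" for m x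
  define m where "m = (LEAST m. \<exists>x. R m x)"
  have Rn: "\<exists>x. R n x" using x0 by (auto simp: R_def)
  then have "\<exists>x. R m x" unfolding m_def by (rule LeastI)
  then obtain x where Rx: "R m x" by blast
  have mn: "m \<le> n" unfolding m_def using Rn by (rule Least_le)
  have x: "x \<in> W" "x \<in> carrier_vec n" "x \<noteq> 0\<^sub>v n" using Rx W by (auto simp: R_def)
  \<comment> \<open>Empty support would mean that the invertible \<open>Q\<close> sends the nonzero
    \<open>x\<close> to zero.\<close>
  have "m \<noteq> 0"
  proof
    assume "m = 0"
    then have "Q *\<^sub>v x = 0\<^sub>v n" using Rx Q by (intro eq_vecI) (auto simp: R_def)
    then have "(P * Q) *\<^sub>v x = 0\<^sub>v n" using P Q x by auto
    then show False using PQ x by simp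
  qed
  then obtain k where k: "m = Suc k" by (cases m) auto
  have kn: "k < n" using k mn by simp
  \<comment> \<open>Coordinate \<open>k\<close> is the last at which \<open>Q *\<^sub>v x\<close>
    can be nonzero. As \<open>T\<close> is upper triangular, \<open>T - c\<close> multiplies that
    coordinate by \<open>T $$ (k, k) - c\<close>, which is zero, and keeps the later ones
    zero.\<close>
  define c where "c = T $$ (k, k)"
  define y where "y = A *\<^sub>v x - c \<cdot>\<^sub>v x"
  define z where "z = Q *\<^sub>v x"
  have z: "z \<in> carrier_vec n" "\<And>i. k < i \<Longrightarrow> i < n \<Longrightarrow> z $ i = 0"
    using Rx Q x k by (auto simp: R_def z_def)
  have "Q *\<^sub>v y = Q *\<^sub>v (A *\<^sub>v x) - Q *\<^sub>v (c \<cdot>\<^sub>v x)"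
    unfolding y_def using Q A x by (intro mult_minus_distrib_mat_vec) auto
  also have "Q *\<^sub>v (A *\<^sub>v x) = T *\<^sub>v z"
    using Q A T x QA by (metis assoc_mult_mat_vec z_def)
  also have "Q *\<^sub>v (c \<cdot>\<^sub>v x) = c \<cdot>\<^sub>v z"
    using Q x by (simp add: z_def mult_mat_vec)
  finally have Qy: "Q *\<^sub>v y = T *\<^sub>v z - c \<cdot>\<^sub>v z" .
  have "(Q *\<^sub>v y) $ i = 0" if i: "i < n" "k \<le> i" for i
  proof -
    have "(T *\<^sub>v z) $ i = (\<Sum>j<n. T $$ (i, j) * z $ j)"
      using T z i by (simp add: scalar_prod_def atLeast0LessThan)
    also have "\<dots> = (\<Sum>j<n. if j = i then T $$ (i, i) * z $ i else 0)"
    proof (rule sum.cong)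
      fix j assume "j \<in> {..<n}"
      then show "T $$ (i, j) * z $ j = (if j = i then T $$ (i, i) * z $ i else 0)"
        using upper_triangularD[OF ut, of j i] T z(2)[of j] i by (cases j i rule: linorder_cases) auto
    qed simp
    also have "\<dots> = T $$ (i, i) * z $ i" using i by simp
    finally show ?thesis
      unfolding Qy using T z i by (cases "i = k") (auto simp: c_def)
  qed
  \<comment> \<open>Since \<open>y\<close> lies in \<open>W\<close> and its support is shorter than
    the minimum, only \<open>y = 0\<close> remains.\<close>
  moreover have "\<not> R k y" using not_less_Least[of k "\<lambda>m. \<exists>x. R m x"] k by (auto simp: m_def)
  moreover have "y \<in> W" unfolding y_def by (rule inv) (rule x)
  ultimately have y0: "y = 0\<^sub>v n" by (auto simp: R_def)
  have "A *\<^sub>v x = c \<cdot>\<^sub>v x"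
  proof (rule eq_vecI)
    fix i assume "i < dim_vec (c \<cdot>\<^sub>v x)"
    then have i: "i < n" using x by simp
    have "y $ i = 0" using y0 i by simp
    then show "(A *\<^sub>v x) $ i = (c \<cdot>\<^sub>v x) $ i" using i A x by (simp add: y_def)
  qed (use A x in simp)
  with x show thesis by (intro that)
qed

section \<open>Adjoints and the Hermitian product, which is conjugate-linear in its second
  argument\<close>

lemma mat_adjoint_carrier [simp]:
  "A \<in> carrier_mat m n \<Longrightarrow> mat_adjoint A \<in> carrier_mat n m"
  by (auto simp: mat_adjoint_def mat_of_rows_def)

lemma cscalar_prod_mat_adjoint:
  fixes A :: "complex mat"
  assumes A: "A \<in> carrier_mat m n" and x: "x \<in> carrier_vec n" and y: "y \<in> carrier_vec m"
  shows "(A *\<^sub>v x) \<bullet>c y = x \<bullet>c (mat_adjoint A *\<^sub>v y)"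
proof -
  have ent: "mat_adjoint A $$ (j, i) = cnj (A $$ (i, j))" if "i < m" "j < n" for i j
    using that A by (simp add: mat_adjoint_def mat_of_rows_def)
  have "(A *\<^sub>v x) \<bullet>c y = (\<Sum>i<m. (\<Sum>j<n. A $$ (i, j) * x $ j) * cnj (y $ i))"
    using A x y by (simp add: scalar_prod_def atLeast0LessThan)
  also have "\<dots> = (\<Sum>j<n. x $ j * (\<Sum>i<m. A $$ (i, j) * cnj (y $ i)))"
    unfolding sum_distrib_right sum_distrib_left by (subst sum.swap) (simp add: ac_simps)
  also have "\<dots> = x \<bullet>c (mat_adjoint A *\<^sub>v y)"
    using A x y ent carrier_matD[OF mat_adjoint_carrier[OF A]]
    by (simp add: scalar_prod_def atLeast0LessThan)
  finally show ?thesis .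
qed

lemma cscalar_prod_cnj:
  fixes x y :: "complex vec"
  assumes "x \<in> carrier_vec n" "y \<in> carrier_vec n"
  shows "cnj (x \<bullet>c y) = y \<bullet>c x"
  using assms by (simp add: scalar_prod_def mult.commute)

lemma cscalar_prod_diff_smult_left:
  fixes x y z :: "complex vec"
  assumes "x \<in> carrier_vec n" "y \<in> carrier_vec n" "z \<in> carrier_vec n"
  shows "(x - c \<cdot>\<^sub>v y) \<bullet>c z = x \<bullet>c z - c * (y \<bullet>c z)"
  using assms by (simp add: scalar_prod_def sum_distrib_left sum_subtractf algebra_simps)

lemma cscalar_prod_smult_left:
  fixes x y :: "complex vec"
  assumes "x \<in> carrier_vec n" "y \<in> carrier_vec n"
  shows "(c \<cdot>\<^sub>v x) \<bullet>c y = c * (x \<bullet>c y)"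
  using assms by (simp add: scalar_prod_def sum_distrib_left algebra_simps)

lemma cscalar_prod_smult_right:
  fixes x y :: "complex vec"
  assumes "x \<in> carrier_vec n" "y \<in> carrier_vec n"
  shows "x \<bullet>c (c \<cdot>\<^sub>v y) = cnj c * (x \<bullet>c y)"
  using assms by (simp add: scalar_prod_def sum_distrib_left algebra_simps)

section \<open>Spectral decomposition of normal matrices\<close>

text \<open>Normality makes \<open>h\<close>, the adjoint applied to \<open>x\<close>, satisfy
  \<open>A *\<^sub>v h = c \<cdot>\<^sub>v h\<close>, so the defect \<open>w\<close> does too.
  Moving \<open>A\<close> across the product then gives
  \<open>h \<bullet>c w = cnj c * (x \<bullet>c w)\<close>, which says that \<open>w\<close> is
  orthogonal to itself.\<close>

lemma normal_mat_adjoint_eigenvector: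
  assumes A: "A \<in> carrier_mat n n" and normal: "normal_mat A"
    and x: "x \<in> carrier_vec n" and eig: "A *\<^sub>v x = c \<cdot>\<^sub>v x"
  shows "mat_adjoint A *\<^sub>v x = cnj c \<cdot>\<^sub>v x"
proof -
  let ?H = "mat_adjoint A"
  have H: "?H \<in> carrier_mat n n" using A by simp
  define h where "h = ?H *\<^sub>v x"
  define w where "w = h - cnj c \<cdot>\<^sub>v x"
  have h: "h \<in> carrier_vec n" unfolding h_def using mult_mat_vec_carrier[OF H x] .
  have w: "w \<in> carrier_vec n" using h x by (simp add: w_def)
  have "A *\<^sub>v h = ?H *\<^sub>v (A *\<^sub>v x)"
    using normal A H x unfolding normal_mat_def h_def by (metis assoc_mult_mat_vec)
  also have "\<dots> = c \<cdot>\<^sub>v h" unfolding h_def using eig H x by (simp add: mult_mat_vec)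
  finally have AH: "A *\<^sub>v h = c \<cdot>\<^sub>v h" .
  have "A *\<^sub>v w = A *\<^sub>v h - A *\<^sub>v (cnj c \<cdot>\<^sub>v x)"
    unfolding w_def using A h x by (intro mult_minus_distrib_mat_vec) auto
  also have "\<dots> = c \<cdot>\<^sub>v h - cnj c \<cdot>\<^sub>v (c \<cdot>\<^sub>v x)"
    using A x AH eig by (simp add: mult_mat_vec)
  also have "\<dots> = c \<cdot>\<^sub>v w"
    using h x by (intro eq_vecI) (auto simp: w_def algebra_simps)
  finally have Aw: "A *\<^sub>v w = c \<cdot>\<^sub>v w" .
  have "h \<bullet>c w = cnj (w \<bullet>c h)"
    using cscalar_prod_cnj[of w n h] w h by simp
  also have "w \<bullet>c h = c * (w \<bullet>c x)"
    using cscalar_prod_mat_adjoint[OF A w x] cscalar_prod_smult_left[OF w x] Aw by (simp add: h_def)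
  also have "cnj \<dots> = cnj c * (x \<bullet>c w)" using cscalar_prod_cnj[OF w x] by simp
  finally have hw: "h \<bullet>c w = cnj c * (x \<bullet>c w)" .
  have "w \<bullet>c w = h \<bullet>c w - cnj c * (x \<bullet>c w)"
    unfolding w_def by (rule cscalar_prod_diff_smult_left) (use h x in auto)
  then have "w \<bullet>c w = 0" using hw by simp
  then have "w = 0\<^sub>v n" using conjugate_square_eq_0_vec[OF w] by simp
  then have "(h - cnj c \<cdot>\<^sub>v x) $ i = 0" if "i < n" for i
    using that by (simp add: w_def[symmetric])
  then show ?thesis unfolding h_def[symmetric] using h x by (intro eq_vecI) auto
qed

text \<open>The adjoint acts on \<open>u\<close> by \<open>cnj c\<close>, and conjugate-linearity
  turns this back into \<open>c\<close>. Thus \<open>A\<close> acts diagonally on the products with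
  its eigenvectors.\<close>

lemma normal_mat_cscalar_eigenvector:
  assumes A: "A \<in> carrier_mat n n" and normal: "normal_mat A"
    and u: "u \<in> carrier_vec n" and eig: "A *\<^sub>v u = c \<cdot>\<^sub>v u" and x: "x \<in> carrier_vec n"
  shows "(A *\<^sub>v x) \<bullet>c u = c * (x \<bullet>c u)"
  using cscalar_prod_mat_adjoint[OF A x u] normal_mat_adjoint_eigenvector[OF A normal u eig]
    cscalar_prod_smult_right[OF x u] by simp

text \<open>Induction on \<open>k\<close>: the orthogonal complement of the eigenvectors found so
  far is invariant by the preceding lemma and, as fewer than \<open>n\<close> have been found,
  nonzero; hence it contains a further eigenvector.\<close>

lemma normal_mat_orthogonal_eigenvectors:
  assumes A: "A \<in> carrier_mat n n" and normal: "normal_mat A" and "k \<le> n"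
  shows "\<exists>u e. (\<forall>i<k. u i \<in> carrier_vec n \<and> u i \<noteq> 0\<^sub>v n \<and> A *\<^sub>v u i = e i \<cdot>\<^sub>v u i) \<and>
    (\<forall>i<k. \<forall>j<k. i \<noteq> j \<longrightarrow> u i \<bullet>c u j = 0)"
  using \<open>k \<le> n\<close>
proof (induction k)
  case (Suc k)
  from Suc.IH[OF Suc_leD[OF Suc.prems]] obtain u e where
    u: "\<And>i. i < k \<Longrightarrow> u i \<in> carrier_vec n" "\<And>i. i < k \<Longrightarrow> u i \<noteq> 0\<^sub>v n"
      "\<And>i. i < k \<Longrightarrow> A *\<^sub>v u i = e i \<cdot>\<^sub>v u i"
    and orth: "\<And>i j. i < k \<Longrightarrow> j < k \<Longrightarrow> i \<noteq> j \<Longrightarrow> u i \<bullet>c u j = 0"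
    by blast
  define W where "W = {x \<in> carrier_vec n. \<forall>i<k. x \<bullet>c u i = 0}"
  have inv: "A *\<^sub>v x - c \<cdot>\<^sub>v x \<in> W" if "x \<in> W" for x c
  proof -
    have x: "x \<in> carrier_vec n" "A *\<^sub>v x \<in> carrier_vec n" using that A by (auto simp: W_def)
    have "(A *\<^sub>v x - c \<cdot>\<^sub>v x) \<bullet>c u i = 0" if i: "i < k" for i
      using cscalar_prod_diff_smult_left[OF x(2,1) u(1)[OF i]] i \<open>x \<in> W\<close>
        normal_mat_cscalar_eigenvector[OF A normal u(1,3)[OF i] x(1)] by (simp add: W_def)
    then show ?thesis using x by (simp add: W_def)
  qed
  \<comment> \<open>Conjugation turns the Hermitian conditions into the bilinear equations of
    \<open>common_kernel_vector\<close>.\<close>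
  define us where "us = map (\<lambda>i. conjugate (u i)) [0..<k]"
  have "set us \<subseteq> carrier_vec n" "length us < n" using u(1) Suc.prems by (auto simp: us_def)
  then obtain x0 where x0: "x0 \<in> carrier_vec n" "x0 \<noteq> 0\<^sub>v n" "\<And>v. v \<in> set us \<Longrightarrow> v \<bullet> x0 = 0"
    using common_kernel_vector by blast
  have "x0 \<bullet>c u i = 0" if "i < k" for i
    using x0(1) x0(3)[of "conjugate (u i)"] u(1)[OF that] that
    by (subst comm_scalar_prod[of _ n]) (auto simp: us_def)
  then have "x0 \<in> W" using x0 by (simp add: W_def)
  then obtain x c where x: "x \<in> W" "x \<noteq> 0\<^sub>v n" "A *\<^sub>v x = c \<cdot>\<^sub>v x"
    using invariant_set_eigenvector[OF A, of W x0] inv x0 by (auto simp: W_def)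
  have xn: "x \<in> carrier_vec n" using x by (simp add: W_def)
  have ort: "x \<bullet>c u i = 0" "u i \<bullet>c x = 0" if "i < k" for i
    using x(1) that cscalar_prod_cnj[OF xn u(1)[OF that]] by (auto simp: W_def)
  show ?case
    using u x xn orth ort
    by (intro exI[of _ "u(k := x)"] exI[of _ "e(k := c)"]) (auto simp: less_Suc_eq)
qed simp

lemma cscalar_prod_self:
  fixes x :: "complex vec"
  shows "x \<bullet>c x = complex_of_real (\<Sum>i<dim_vec x. (cmod (x $ i))\<^sup>2)"
  by (simp add: scalar_prod_def atLeast0LessThan flip: complex_norm_square)

text \<open>The eigenvectors \<open>u i\<close> are orthogonal but not normalised; the weights
  \<open>w i\<close>, their inverse squared lengths, correct for this in Parseval's
  identity.\<close>

lemma normal_mat_spectral: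
  assumes A: "A \<in> carrier_mat n n" and normal: "normal_mat A"
  obtains e :: "nat \<Rightarrow> complex" and u :: "nat \<Rightarrow> complex vec" and w :: "nat \<Rightarrow> real"
  where "spectrum_mset A = mset (map e [0..<n])"
    and "\<And>i. i < n \<Longrightarrow> u i \<in> carrier_vec n" and "\<And>i. i < n \<Longrightarrow> w i > 0"
    and "\<And>x i. x \<in> carrier_vec n \<Longrightarrow> i < n \<Longrightarrow> (A *\<^sub>v x) \<bullet>c u i = e i * (x \<bullet>c u i)"
    and "\<And>x. x \<in> carrier_vec n \<Longrightarrow> x \<bullet>c x = complex_of_real (\<Sum>i<n. w i * (cmod (x \<bullet>c u i))\<^sup>2)"
proof -
  obtain u e where u: "\<And>i. i < n \<Longrightarrow> u i \<in> carrier_vec n" "\<And>i. i < n \<Longrightarrow> u i \<noteq> 0\<^sub>v n"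
      "\<And>i. i < n \<Longrightarrow> A *\<^sub>v u i = e i \<cdot>\<^sub>v u i"
    and orth: "\<And>i j. i < n \<Longrightarrow> j < n \<Longrightarrow> i \<noteq> j \<Longrightarrow> u i \<bullet>c u j = 0"
    using normal_mat_orthogonal_eigenvectors[OF A normal order_refl] by blast
  define U where "U = mat n n (\<lambda>(i, j). u j $ i)"
  \<comment> \<open>Since the columns of \<open>U\<close> need not have unit length, its inverse is
    the adjoint with rescaled rows.\<close>
  define V where "V = corthogonal_inv U"
  define D where "D = mat n n (\<lambda>(i, j). if i = j then e i else 0)"
  have U: "U \<in> carrier_mat n n" and D: "D \<in> carrier_mat n n" by (auto simp: U_def D_def)
  have V: "V \<in> carrier_mat n n" using U by (auto simp: V_def corthogonal_inv_def mat_of_rows_def)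
  have colU: "col U j = u j" if "j < n" for j
    using that u(1)[OF that] by (intro eq_vecI) (auto simp: U_def)
  have "corthogonal_mat U"
    using U colU u orth by (intro corthogonal_matI) (auto simp: conjugate_square_eq_0_vec[of _ n])
  from corthogonal_inv_result[OF this] have VU: "V * U = 1\<^sub>m n"
    using V by (simp add: inverts_mat_def V_def[symmetric])
  have UV: "U * V = 1\<^sub>m n" by (rule mat_mult_left_right_inverse[OF V U VU])
  have "A * U = U * D"
  proof (rule eq_matI)
    fix i j assume "i < dim_row (U * D)" "j < dim_col (U * D)"
    then have ij: "i < n" "j < n" using U D by auto
    have "(A * U) $$ (i, j) = (A *\<^sub>v u j) $ i" using ij A U colU by simp
    also have "\<dots> = e j * U $$ (i, j)" using u(1,3)[of j] ij by (simp add: U_def)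
    also have "\<dots> = (\<Sum>k<n. if k = j then U $$ (i, k) * e j else 0)" using ij by simp
    also have "\<dots> = (\<Sum>k<n. U $$ (i, k) * D $$ (k, j))"
      using ij by (intro sum.cong) (auto simp: D_def)
    also have "\<dots> = (U * D) $$ (i, j)"
      using ij U D by (simp add: scalar_prod_def atLeast0LessThan)
    finally show "(A * U) $$ (i, j) = (U * D) $$ (i, j)" .
  qed (use A U D in auto)
  then have "U * D * V = A * U * V" by simp
  also have "\<dots> = A * (U * V)" by (rule assoc_mult_mat[OF A U V])
  finally have "A = U * D * V" using UV A by simp
  then have "similar_mat A D"
    unfolding similar_mat_def similar_mat_wit_def Let_def
    using A U D V UV VU by (intro exI[of _ U] exI[of _ V]) auto
  then have "char_poly A = char_poly D" by (rule char_poly_similar)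
  also have "\<dots> = (\<Prod>a\<leftarrow>diag_mat D. [:- a, 1:])"
    by (rule char_poly_upper_triangular[OF D]) (auto simp: upper_triangular_def D_def)
  also have "diag_mat D = map e [0..<n]" by (auto simp: diag_mat_def D_def)
  finally have "spectrum_mset A = proots (\<Prod>a\<leftarrow>map e [0..<n]. [:- a, 1:])"
    by (simp add: spectrum_mset_def)
  also have "proots (\<Prod>a\<leftarrow>es. [:- a, 1:]) = mset es" for es :: "complex list"
  proof (induction es)
    case (Cons a es)
    have "(\<Prod>a\<leftarrow>es. [:- a, 1:]) \<noteq> 0" by (auto simp: prod_list_zero_iff)
    then show ?case using Cons by (simp add: proots_mult del: mult_pCons_left)
  qed simp
  finally have spec: "spectrum_mset A = mset (map e [0..<n])" .
  define w where "w i = inverse (Re (u i \<bullet>c u i))" for i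
  have norm_u: "u i \<bullet>c u i = complex_of_real (inverse (w i))" "w i > 0" if i: "i < n" for i
  proof -
    have re: "u i \<bullet>c u i = complex_of_real (Re (u i \<bullet>c u i))" "Re (u i \<bullet>c u i) \<ge> 0"
      by (simp_all add: cscalar_prod_self sum_nonneg)
    have "u i \<bullet>c u i \<noteq> 0" using conjugate_square_eq_0_vec[OF u(1)[OF i]] u(2)[OF i] by simp
    then have "Re (u i \<bullet>c u i) \<noteq> 0" using re(1) by force
    with re show "u i \<bullet>c u i = complex_of_real (inverse (w i))" "w i > 0" by (simp_all add: w_def)
  qed
  have parseval: "y \<bullet>c y = complex_of_real (\<Sum>i<n. w i * (cmod (y \<bullet>c u i))\<^sup>2)"
    if y: "y \<in> carrier_vec n" for y
  proof -
    define c where "c = V *\<^sub>v y"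
    have "y = U *\<^sub>v c" using UV U V y by (simp add: c_def assoc_mult_mat_vec[symmetric])
    moreover have "c \<in> carrier_vec n" unfolding c_def by (rule mult_mat_vec_carrier[OF V y])
    ultimately have yi: "y $ l = (\<Sum>j<n. c $ j * u j $ l)" if "l < n" for l
      using that by (simp add: scalar_prod_def atLeast0LessThan U_def mult.commute)
    have lin: "y \<bullet>c z = (\<Sum>j<n. c $ j * (u j \<bullet>c z))" if z: "z \<in> carrier_vec n" for z
    proof -
      have "y \<bullet>c z = (\<Sum>l<n. (\<Sum>j<n. c $ j * u j $ l) * cnj (z $ l))"
        using z yi by (simp add: scalar_prod_def atLeast0LessThan)
      also have "\<dots> = (\<Sum>j<n. c $ j * (\<Sum>l<n. u j $ l * cnj (z $ l)))"
        unfolding sum_distrib_right sum_distrib_left by (subst sum.swap) (simp add: ac_simps)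
      also have "\<dots> = (\<Sum>j<n. c $ j * (u j \<bullet>c z))"
        using z by (simp add: scalar_prod_def atLeast0LessThan)
      finally show ?thesis .
    qed
    \<comment> \<open>Orthogonality leaves a single term when the expansion of \<open>y\<close> is
      paired with \<open>u i\<close>.\<close>
    have c: "c $ i = w i * (y \<bullet>c u i)" if i: "i < n" for i
    proof -
      have "y \<bullet>c u i = (\<Sum>j<n. if j = i then c $ i * (u i \<bullet>c u i) else 0)"
        unfolding lin[OF u(1)[OF i]] using orth i by (intro sum.cong) auto
      also have "\<dots> = c $ i * (u i \<bullet>c u i)" using i by simp
      finally show ?thesis using norm_u[OF i] by (simp add: field_simps)
    qed
    have "y \<bullet>c y = (\<Sum>j<n. w j * (y \<bullet>c u j) * cnj (y \<bullet>c u j))"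
      unfolding lin[OF y] using c cscalar_prod_cnj[OF y u(1)] by (intro sum.cong) auto
    also have "\<dots> = complex_of_real (\<Sum>i<n. w i * (cmod (y \<bullet>c u i))\<^sup>2)"
      by (simp add: mult.assoc flip: complex_norm_square)
    finally show ?thesis .
  qed
  show thesis
    by (rule that[of e u w]) (use spec u norm_u parseval
      normal_mat_cscalar_eigenvector[OF A normal] in auto)
qed

section \<open>Eigenvalue counts in a disc and the rank bound\<close>

text \<open>One half of the absolute value. The rank enters only through the number of equations
  forcing \<open>A\<close> and \<open>B\<close> to agree, a condition symmetric in the two
  matrices.\<close>

lemma normal_mat_disc_count_le:
  assumes A: "A \<in> carrier_mat n n" "normal_mat A" and B: "B \<in> carrier_mat n n" "normal_mat B"
    and vs: "set vs \<subseteq> carrier_vec n"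
    and agree: "\<And>x. x \<in> carrier_vec n \<Longrightarrow> (\<And>v. v \<in> set vs \<Longrightarrow> v \<bullet> x = 0) \<Longrightarrow> A *\<^sub>v x = B *\<^sub>v x"
  shows "size {#z \<in># spectrum_mset A. z \<in> cball a r#}
    \<le> size {#z \<in># spectrum_mset B. z \<in> cball a r#} + length vs"
\<comment> \<open>For negative \<open>r\<close> the ball is empty; otherwise the sign allows
  squaring the strict inequality below.\<close>
proof (cases "r \<ge> 0")
  case r: True
  obtain e u w where specA: "spectrum_mset A = mset (map e [0..<n])"
    and u: "\<And>i. i < n \<Longrightarrow> u i \<in> carrier_vec n" and w: "\<And>i. i < n \<Longrightarrow> w i > 0"
    and Au: "\<And>x i. x \<in> carrier_vec n \<Longrightarrow> i < n \<Longrightarrow> (A *\<^sub>v x) \<bullet>c u i = e i * (x \<bullet>c u i)"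
    and parA: "\<And>x. x \<in> carrier_vec n \<Longrightarrow> x \<bullet>c x = complex_of_real (\<Sum>i<n. w i * (cmod (x \<bullet>c u i))\<^sup>2)"
    by (fact normal_mat_spectral[OF A])
  obtain e' u' w' where specB: "spectrum_mset B = mset (map e' [0..<n])"
    and u': "\<And>i. i < n \<Longrightarrow> u' i \<in> carrier_vec n" and w': "\<And>i. i < n \<Longrightarrow> w' i > 0"
    and Bu: "\<And>x i. x \<in> carrier_vec n \<Longrightarrow> i < n \<Longrightarrow> (B *\<^sub>v x) \<bullet>c u' i = e' i * (x \<bullet>c u' i)"
    and parB: "\<And>x. x \<in> carrier_vec n \<Longrightarrow> x \<bullet>c x = complex_of_real (\<Sum>i<n. w' i * (cmod (x \<bullet>c u' i))\<^sup>2)"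
    by (fact normal_mat_spectral[OF B])
  have count: "size {#z \<in># mset (map f [0..<n]). z \<in> cball a r#} =
      length (filter (\<lambda>i. f i \<in> cball a r) [0..<n])" for f
    unfolding mset_filter[symmetric] size_mset by (simp add: filter_map o_def)
  have compl: "length (filter (\<lambda>i. e i \<notin> cball a r) [0..<n]) =
      n - length (filter (\<lambda>i. e i \<in> cball a r) [0..<n])"
    using sum_length_filter_compl[of "\<lambda>i. e i \<in> cball a r" "[0..<n]"] by simp
  show ?thesis
  proof (rule ccontr)
    assume neg: "\<not> ?thesis"
    \<comment> \<open>With \<open>p\<close> and \<open>q\<close> eigenvalues of \<open>A\<close> and
      \<open>B\<close> in the disc, this list has \<open>n - p + q + length vs\<close> entries,
      fewer than \<open>n\<close> by \<open>neg\<close>.\<close>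
    define L where "L = map (\<lambda>i. conjugate (u i)) (filter (\<lambda>i. e i \<notin> cball a r) [0..<n]) @
      map (\<lambda>i. conjugate (u' i)) (filter (\<lambda>i. e' i \<in> cball a r) [0..<n]) @ vs"
    \<comment> \<open>Ensures that the natural-number subtraction in \<open>compl\<close> does not
      truncate.\<close>
    have "length (filter (\<lambda>i. e i \<in> cball a r) [0..<n]) \<le> n"
      using length_filter_le[of _ "[0..<n]"] by simp
    then have "length L < n" using neg compl unfolding specA specB count L_def by simp
    moreover have "set L \<subseteq> carrier_vec n" using u u' vs by (auto simp: L_def)
    ultimately obtain x where x: "x \<in> carrier_vec n" "x \<noteq> 0\<^sub>v n"
      and orth: "\<And>v. v \<in> set L \<Longrightarrow> v \<bullet> x = 0" using common_kernel_vector by blast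
    have xu: "x \<bullet>c u i = 0" if "i < n" "e i \<notin> cball a r" for i
      using orth[of "conjugate (u i)"] that x u[OF that(1)]
      by (subst comm_scalar_prod[of _ n]) (auto simp: L_def)
    have xu': "x \<bullet>c u' i = 0" if "i < n" "e' i \<in> cball a r" for i
      using orth[of "conjugate (u' i)"] that x u'[OF that(1)]
      by (subst comm_scalar_prod[of _ n]) (auto simp: L_def)
    have AB: "A *\<^sub>v x = B *\<^sub>v x" using orth by (intro agree x) (auto simp: L_def)
    define y where "y = A *\<^sub>v x - a \<cdot>\<^sub>v x"
    have Ax: "A *\<^sub>v x \<in> carrier_vec n" using A x by simp
    have y: "y \<in> carrier_vec n" using x Ax by (simp add: y_def)
    have yu: "y \<bullet>c u i = (e i - a) * (x \<bullet>c u i)" if "i < n" for i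
      using cscalar_prod_diff_smult_left[OF Ax x(1) u[OF that]] Au[OF x(1) that]
      by (simp add: y_def algebra_simps)
    \<comment> \<open>By \<open>AB\<close>, \<open>y\<close> is also
      \<open>B *\<^sub>v x - a \<cdot>\<^sub>v x\<close>, so one vector has coordinates in both
      eigenbases.\<close>
    have yu': "y \<bullet>c u' i = (e' i - a) * (x \<bullet>c u' i)" if "i < n" for i
      using cscalar_prod_diff_smult_left[OF Ax x(1) u'[OF that]] Bu[OF x(1) that] AB
      by (simp add: y_def algebra_simps)
    \<comment> \<open>Only eigenvalues in the disc contribute, and for them
      \<open>cmod (e i - a) \<le> r\<close>.\<close>
    have "(\<Sum>i<n. w i * (cmod (y \<bullet>c u i))\<^sup>2) \<le> (\<Sum>i<n. r\<^sup>2 * (w i * (cmod (x \<bullet>c u i))\<^sup>2))"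
    proof (rule sum_mono)
      fix i assume "i \<in> {..<n}"
      then have i: "i < n" by simp
      have "(cmod (y \<bullet>c u i))\<^sup>2 \<le> r\<^sup>2 * (cmod (x \<bullet>c u i))\<^sup>2"
      proof (cases "e i \<in> cball a r")
        case True
        then have "(cmod (e i - a))\<^sup>2 \<le> r\<^sup>2"
          by (intro power_mono) (simp_all add: dist_norm norm_minus_commute)
        then show ?thesis using i by (simp add: yu norm_mult power_mult_distrib mult_right_mono)
      qed (use i in \<open>simp add: yu xu\<close>)
      then have "w i * (cmod (y \<bullet>c u i))\<^sup>2 \<le> w i * (r\<^sup>2 * (cmod (x \<bullet>c u i))\<^sup>2)"
        using w[OF i] by (intro mult_left_mono) auto
      then show "w i * (cmod (y \<bullet>c u i))\<^sup>2 \<le> r\<^sup>2 * (w i * (cmod (x \<bullet>c u i))\<^sup>2)"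
        by (simp add: ac_simps)
    qed
    then have upper: "Re (y \<bullet>c y) \<le> r\<^sup>2 * Re (x \<bullet>c x)"
      unfolding parA[OF x(1)] parA[OF y] Re_complex_of_real sum_distrib_left .
    have strict: "r\<^sup>2 * (w' i * (cmod (x \<bullet>c u' i))\<^sup>2) < w' i * (cmod (y \<bullet>c u' i))\<^sup>2"
      if i: "i < n" and nz: "x \<bullet>c u' i \<noteq> 0" for i
    proof -
      have "r < cmod (e' i - a)"
        using xu'[OF i] nz by (force simp: dist_norm norm_minus_commute)
      then have "r\<^sup>2 < (cmod (e' i - a))\<^sup>2" using r by (intro power_strict_mono) auto
      then have "(w' i * (cmod (x \<bullet>c u' i))\<^sup>2) * r\<^sup>2 < (w' i * (cmod (x \<bullet>c u' i))\<^sup>2) * (cmod (e' i - a))\<^sup>2"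
        using w'[OF i] nz by (intro mult_strict_left_mono) auto
      then show ?thesis using i by (simp add: yu' norm_mult power_mult_distrib ac_simps)
    qed
    \<comment> \<open>One nonzero coordinate makes the summed inequality strict; were all zero,
      Parseval would give \<open>x = 0\<close>.\<close>
    have "\<exists>i<n. x \<bullet>c u' i \<noteq> 0"
    proof (rule ccontr)
      assume "\<not> ?thesis"
      then have "x \<bullet>c x = 0" using parB[OF x(1)] by simp
      then show False using conjugate_square_eq_0_vec[OF x(1)] x(2) by simp
    qed
    then obtain k where k: "k < n" "x \<bullet>c u' k \<noteq> 0" by blast
    have "(\<Sum>i<n. r\<^sup>2 * (w' i * (cmod (x \<bullet>c u' i))\<^sup>2)) < (\<Sum>i<n. w' i * (cmod (y \<bullet>c u' i))\<^sup>2)"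
    proof (rule sum_strict_mono_ex1)
      show "\<forall>i\<in>{..<n}. r\<^sup>2 * (w' i * (cmod (x \<bullet>c u' i))\<^sup>2) \<le> w' i * (cmod (y \<bullet>c u' i))\<^sup>2"
      proof
        fix i assume "i \<in> {..<n}"
        then have i: "i < n" by simp
        show "r\<^sup>2 * (w' i * (cmod (x \<bullet>c u' i))\<^sup>2) \<le> w' i * (cmod (y \<bullet>c u' i))\<^sup>2"
          using strict[OF i] yu'[OF i] by (cases "x \<bullet>c u' i = 0") auto
      qed
    qed (use k strict in auto)
    then have "r\<^sup>2 * Re (x \<bullet>c x) < Re (y \<bullet>c y)"
      unfolding parB[OF x(1)] parB[OF y] Re_complex_of_real sum_distrib_left .
    with upper show False by simp
  qed
qed simp

theorem corollary2:
  fixes A B :: "complex mat" and n :: nat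
  assumes "A \<in> carrier_mat n n" and "B \<in> carrier_mat n n"
    and "normal_mat A" and "normal_mat B"
  shows "disc_dist (spectrum_mset A) (spectrum_mset B) \<le> int (vec_space.rank n (A - B))"
proof -
  note A = assms(1,3) and B = assms(2,4)
  have "A - B \<in> carrier_mat n n" by (rule minus_carrier_mat[OF B(1)])
  then obtain vs where vs: "set vs \<subseteq> carrier_vec n" "length vs = vec_space.rank n (A - B)"
    and ker: "\<And>x. x \<in> carrier_vec n \<Longrightarrow> (\<And>v. v \<in> set vs \<Longrightarrow> v \<bullet> x = 0) \<Longrightarrow> (A - B) *\<^sub>v x = 0\<^sub>v n"
    by (rule vec_space.rank_kernel_equations) blast
  have agree: "A *\<^sub>v x = B *\<^sub>v x" if x: "x \<in> carrier_vec n" and "\<And>v. v \<in> set vs \<Longrightarrow> v \<bullet> x = 0" for x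
  proof (rule eq_vecI)
    fix i assume "i < dim_vec (B *\<^sub>v x)"
    then have i: "i < n" using B by simp
    have "(A - B) *\<^sub>v x = A *\<^sub>v x - B *\<^sub>v x" using A B x by (intro minus_mult_distrib_mat_vec) auto
    with ker[OF that] have "(A *\<^sub>v x - B *\<^sub>v x) $ i = 0" using i by simp
    then show "(A *\<^sub>v x) $ i = (B *\<^sub>v x) $ i" using i A B by simp
  qed (use A B in simp)
  have "d \<le> int (vec_space.rank n (A - B))"
    if "d \<in> disc_discrepancies (spectrum_mset A) (spectrum_mset B)" for d
  proof -
    from that obtain a r where d: "d = \<bar>int (size {#x \<in># spectrum_mset A. x \<in> cball a r#})
        - int (size {#x \<in># spectrum_mset B. x \<in> cball a r#})\<bar>"
      unfolding disc_discrepancies_def mem_Collect_eq by (elim exE conjE)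
    have "size {#x \<in># spectrum_mset A. x \<in> cball a r#}
        \<le> size {#x \<in># spectrum_mset B. x \<in> cball a r#} + length vs"
      using agree by (rule normal_mat_disc_count_le[OF A B vs(1)])
    \<comment> \<open>The same list \<open>vs\<close> serves with the roles of \<open>A\<close> and
      \<open>B\<close> exchanged.\<close>
    moreover have "size {#x \<in># spectrum_mset B. x \<in> cball a r#}
        \<le> size {#x \<in># spectrum_mset A. x \<in> cball a r#} + length vs"
      using agree[symmetric] by (rule normal_mat_disc_count_le[OF B A vs(1)])
    ultimately show ?thesis unfolding d vs(2)[symmetric] by linarith
  qed
  then show ?thesis
    unfolding disc_dist_def
    by (intro Max.boundedI finite_disc_discrepancies disc_discrepancies_nonempty)
qed

end
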